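(* Let $p_1>0$, $p_2\ne0$, $p_3>0$ with $p_1^2+p_2^2=p_3^2$, let $\Theta=\tan^{-1}\frac{p_1}{p_2+p_3}\in(0,\pi/2)$ and $\rho>0$, and consider the system $$\mathcal{D}'=2\mathcal{I}(p_1\mathcal{D}+(p_2-p_3)\mathcal{R}),\qquad\mathcal{R}'=2\mathcal{I}(-(p_2+p_3)\mathcal{D}+p_1\mathcal{R}),\qquad\mathcal{I}'=-2p_1(\mathcal{D}^2+\mathcal{R}^2)+4p_3\mathcal{D}\mathcal{R}$$ on $S^2_\rho$. Let $$X=\tfrac{1}{2\sin\Theta}\mathcal{D}(0)+\tfrac{1}{2\cos\Theta}\mathcal{R}(0),\qquad Y=-\tfrac{1}{2\sin\Theta}\mathcal{D}(0)+\tfrac{1}{2\cos\Theta}\mathcal{R}(0),\qquad r=\sqrt{|\rho^2-X^2|},$$ and write $\mathcal{I}_0=\mathcal{I}(0)$. (1) If $|X|<\rho$, then, with $W(t)=((r-\mathcal{I}_0)^2+Y^2)e^{4p_1rt}+((r+\mathcal{I}_0)^2+Y^2)e^{-4p_1rt}-2\mathcal{I}_0^2-2Y^2+2r^2$, $$\mathcal{D}(t)=\sin\Theta\Big(X-\tfrac{4r^2Y}{W(t)}\Big),\qquad\mathcal{R}(t)=\cos\Theta\Big(X+\tfrac{4r^2Y}{W(t)}\Big),$$ $$\mathcal{I}(t)=-r\,\tfrac{((r-\mathcal{I}_0)^2+Y^2)e^{4p_1rt}-((r+\mathcal{I}_0)^2+Y^2)e^{-4p_1rt}}{W(t)}.$$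 (2) If $|X|=\rho$, then, with $W(t)=(2p_1t(\mathcal{I}_0^2+Y^2)-\mathcal{I}_0)^2+Y^2$, $$\mathcal{D}(t)=\sin\Theta\Big(X-\tfrac{(\mathcal{I}_0^2+Y^2)Y}{W(t)}\Big),\qquad\mathcal{R}(t)=\cos\Theta\Big(X+\tfrac{(\mathcal{I}_0^2+Y^2)Y}{W(t)}\Big),$$ $$\mathcal{I}(t)=-\tfrac{(\mathcal{I}_0^2+Y^2)(2p_1t(\mathcal{I}_0^2+Y^2)-\mathcal{I}_0)}{W(t)}.$$ (3) If $|X|>\rho$, then, with $W(t)=(\mathcal{I}_0^2+Y^2+r^2)-2r\mathcal{I}_0\sin(4p_1rt)-(\mathcal{I}_0^2+Y^2-r^2)\cos(4p_1rt)$, $$\mathcal{D}(t)=\sin\Theta\Big(X-\tfrac{2r^2Y}{W(t)}\Big),\qquad\mathcal{R}(t)=\cos\Theta\Big(X+\tfrac{2r^2Y}{W(t)}\Big),$$ $$\mathcal{I}(t)=r\,\tfrac{2r\mathcal{I}_0\cos(4p_1rt)-(\mathcal{I}_0^2+Y^2-r^2)\sin(4p_1rt)}{W(t)}.$$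
   Context: $S^2_\rho=\{(x,y,z)\in\mathbb{R}^3: x^2+y^2+z^2=\rho^2\}$; the unknown $(\mathcal{D},\mathcal{R},\mathcal{I})$ is real valued with initial data in $S_\rho^2$, and the system preserves $S^2_\rho$. In case (2), when $\mathcal{I}_0=Y=0$ (a fixed point) the fractions, formally $0/0$, are read as $0$. *)

theory Defs
  imports "HOL-Analysis.Analysis"
begin

definition S2 :: "real \<Rightarrow> (real \<times> real \<times> real) set" where
  "S2 \<rho> = {(x, y, z). x\<^sup>2 + y\<^sup>2 + z\<^sup>2 = \<rho>\<^sup>2}"

text \<open>Derivatives are taken within \<open>J\<close>, so they are one-sided at an end point of the
  time interval \<open>J\<close> that belongs to \<open>J\<close>.\<close>

definition solves_DRI_on ::
  "real set \<Rightarrow> real \<Rightarrow> real \<Rightarrow> real \<Rightarrow> (real \<Rightarrow> real) \<Rightarrow> (real \<Rightarrow> real) \<Rightarrow> (real \<Rightarrow> real) \<Rightarrow> bool" where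
  "solves_DRI_on J p1 p2 p3 D R I \<longleftrightarrow>
    (\<forall>t\<in>J.
      (D has_real_derivative 2 * I t * (p1 * D t + (p2 - p3) * R t)) (at t within J) \<and>
      (R has_real_derivative 2 * I t * (- (p2 + p3) * D t + p1 * R t)) (at t within J) \<and>
      (I has_real_derivative - 2 * p1 * ((D t)\<^sup>2 + (R t)\<^sup>2) + 4 * p3 * D t * R t) (at t within J))"

end

(* In the coordinates D = sin \<Theta> (X - y), R = cos \<Theta> (X + y) the function X is a constant of motion, and with the
   conservation of D^2 + R^2 + I^2 the complex function z = I + i y solves the Riccati equation
   z' = 2 p1 (z^2 - K), where K = \<rho>^2 - X^2. It is linearised by \<phi>' = - 2 p1 z \<phi>, \<phi> 0 = 1, which gives
   \<phi>'' = 4 p1^2 K \<phi>. The three cases are K > 0, K = 0 and K < 0, and W is a multiple of |\<phi>|^2. *)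

theory Submission
  imports Defs
begin

section \<open>Uniqueness for linear equations, and the Riccati equation\<close>

text \<open>Integrating factor: if \<open>F\<close> is an antiderivative of \<open>f\<close>, then
  \<open>E * exp (- F)\<close> has derivative zero. \<open>J\<close> may be open or unbounded, so
  the argument runs on the compact interval between \<open>s\<close> and \<open>t\<close>, where a
  continuous \<open>f\<close> has an antiderivative.\<close>

lemma linear_ode_zero:
  fixes E f :: "real \<Rightarrow> real"
  assumes J: "is_interval J" "s \<in> J" "t \<in> J"
    and f: "continuous_on J f"
    and E: "\<And>u. u \<in> J \<Longrightarrow> (E has_real_derivative f u * E u) (at u within J)"
    and "E s = 0"
  shows "E t = 0"
proof -
  define a b where "a = min s t" and "b = max s t"
  have ab: "{a..b} \<subseteq> J"
  proof
    fix u assume "u \<in> {a..b}"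
    then show "u \<in> J"
      using J unfolding a_def b_def is_interval_1
      by (metis atLeastAtMost_iff max_def min_def)
  qed
  have st: "s \<in> {a..b}" "t \<in> {a..b}" by (auto simp: a_def b_def)
  obtain F where F: "\<And>u. u \<in> {a..b} \<Longrightarrow> (F has_vector_derivative f u) (at u within {a..b})"
    using antiderivative_continuous[OF continuous_on_subset[OF f ab]] by blast
  have "((\<lambda>u. E u * exp (- F u)) has_real_derivative 0) (at u within {a..b})"
    if u: "u \<in> {a..b}" for u
  proof -
    have [derivative_intros]: "(F has_real_derivative f u) (at u within {a..b})"
      using F[OF u] by (simp add: has_real_derivative_iff_has_vector_derivative)
    have [derivative_intros]: "(E has_real_derivative f u * E u) (at u within {a..b})"
      using DERIV_subset[OF E ab] u ab by blast
    show ?thesis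
      by (auto intro!: derivative_eq_intros)
  qed
  then obtain c where "\<And>u. u \<in> {a..b} \<Longrightarrow> E u * exp (- F u) = c"
    using has_field_derivative_zero_constant[of "{a..b}" "\<lambda>u. E u * exp (- F u)"] by auto
  then have "E t * exp (- F t) = E s * exp (- F s)" using st by metis
  with \<open>E s = 0\<close> show ?thesis by simp
qed

text \<open>The Riccati equation \<open>z' = q (z\<^sup>2 - K)\<close> for \<open>z = I + \<i> y\<close>, in real and imaginary parts;
  \<open>\<phi> = C - z 0 * S\<close> has the real part \<open>a\<close> and the imaginary part \<open>b\<close>.\<close>

lemma riccati_solution:
  fixes I y C S :: "real \<Rightarrow> real"
  assumes J: "is_interval J" "0 \<in> J" "t \<in> J"
    and I: "\<And>u. u \<in> J \<Longrightarrow> (I has_real_derivative q * ((I u)\<^sup>2 - (y u)\<^sup>2 - K)) (at u within J)"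
    and y: "\<And>u. u \<in> J \<Longrightarrow> (y has_real_derivative 2 * q * I u * y u) (at u within J)"
    and C: "\<And>u. (C has_real_derivative q * K * S u) (at u)"
    and S: "\<And>u. (S has_real_derivative q * C u) (at u)"
    and "C 0 = 1" "S 0 = 0"
    and CS: "(C t)\<^sup>2 - K * (S t)\<^sup>2 = 1"
  defines "Q \<equiv> (C t - I 0 * S t)\<^sup>2 + (y 0 * S t)\<^sup>2"
  shows "Q \<noteq> 0 \<and> y t = y 0 / Q \<and>
    I t = ((C t - I 0 * S t) * (I 0 * C t - K * S t) - (y 0)\<^sup>2 * S t * C t) / Q"
proof -
  define a b where "a u = C u - I 0 * S u" and "b u = - y 0 * S u" for u
  \<comment> \<open>\<open>a'\<close> and \<open>b'\<close> are the derivatives of \<open>a\<close>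
    and \<open>b\<close> divided by \<open>q\<close>, so that no division by \<open>q\<close>
    occurs.\<close>
  define a' b' where "a' u = K * S u - I 0 * C u" and "b' u = - y 0 * C u" for u
  \<comment> \<open>\<open>q (h1 + \<i> h2) = \<phi>' + q z \<phi>\<close> solves the linear equation \<open>h' = q z h\<close>.\<close>
  define h1 h2 where "h1 u = a' u + I u * a u - y u * b u"
    and "h2 u = b' u + I u * b u + y u * a u" for u
  note defs = a_def b_def a'_def b'_def h1_def h2_def
  \<comment> \<open>The complex equation h' = q z h becomes real and scalar for |h|^2, with the
    coefficient 2 q Re z. At time 0, \<phi> = 1 and \<phi>' = - q z, so h vanishes there.\<close>
  have E: "((\<lambda>u. (h1 u)\<^sup>2 + (h2 u)\<^sup>2) has_real_derivative
      2 * q * I u * ((h1 u)\<^sup>2 + (h2 u)\<^sup>2)) (at u within J)" if u: "u \<in> J" for u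
  proof -
    note [derivative_intros] =
      I[OF u] y[OF u] has_field_derivative_at_within[OF C] has_field_derivative_at_within[OF S]
    have "(h1 has_real_derivative q * (I u * h1 u - y u * h2 u)) (at u within J)"
      unfolding defs
      by (auto intro!: derivative_eq_intros simp: algebra_simps power2_eq_square)
    moreover have "(h2 has_real_derivative q * (I u * h2 u + y u * h1 u)) (at u within J)"
      unfolding defs
      by (auto intro!: derivative_eq_intros simp: algebra_simps power2_eq_square)
    ultimately show ?thesis
      by (auto intro!: derivative_eq_intros simp: algebra_simps power2_eq_square)
  qed
  have "continuous_on J I"
    using I by (meson DERIV_continuous continuous_on_eq_continuous_within)
  then have cont: "continuous_on J (\<lambda>u. 2 * q * I u)" by (intro continuous_intros)
  have "(h1 t)\<^sup>2 + (h2 t)\<^sup>2 = 0"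
    by (rule linear_ode_zero[OF J cont E]) (auto simp: defs assms)
  \<comment> \<open>This is \<phi>' = - q z \<phi>: z is read off from the logarithmic derivative of
    \<phi>.\<close>
  then have h: "a' t = y t * b t - I t * a t" "b' t = - I t * b t - y t * a t"
    by (auto simp: h1_def h2_def sum_power2_eq_zero_iff)
  have Q: "Q = (a t)\<^sup>2 + (b t)\<^sup>2" by (simp add: Q_def defs)
  \<comment> \<open>At a zero of \<phi> the relation \<open>h\<close> makes \<open>a'\<close> and
    \<open>b'\<close> vanish too, which contradicts the Wronskian identity
    \<open>CS\<close>.\<close>
  have "Q \<noteq> 0"
  proof
    assume "Q = 0"
    then have "a t = 0" "b t = 0" by (auto simp: Q sum_power2_eq_zero_iff)
    then have "C t = I 0 * S t" "K * S t = I 0 * C t"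
      using h by (auto simp: defs)
    then have "(C t)\<^sup>2 - K * (S t)\<^sup>2 = 0" by algebra
    with CS show False by simp
  qed
  \<comment> \<open>\<open>y t * Q\<close> is the imaginary part of z |\<phi>|^2. By
    \<open>h\<close> it is the Wronskian of \<open>a\<close> and \<open>b\<close> up to sign, and
    hence \<open>y 0\<close> times that of \<open>C\<close> and \<open>S\<close>, which is 1. The
    real part gives \<open>I t * Q\<close> below.\<close>
  moreover have "y t * Q = - (a t * b' t - b t * a' t)"
    unfolding Q h by (simp add: algebra_simps power2_eq_square)
  then have "y t * Q = y 0 * ((C t)\<^sup>2 - K * (S t)\<^sup>2)"
    by (simp add: defs algebra_simps power2_eq_square)
  then have "y t * Q = y 0" by (simp add: CS)
  moreover have "I t * Q = - (a t * a' t + b t * b' t)"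
    unfolding Q h by (simp add: algebra_simps power2_eq_square)
  then have "I t * Q = (C t - I 0 * S t) * (I 0 * C t - K * S t) - (y 0)\<^sup>2 * S t * C t"
    by (simp add: defs algebra_simps power2_eq_square)
  ultimately show ?thesis by (simp add: eq_divide_eq)
qed

section \<open>Reduction of the system to the Riccati equation\<close>

text \<open>The point (p2, p1) has polar radius p3 and polar angle 2 \<Theta>; these are the
  half-angle formulas. They diagonalise the (D, R) equations later.\<close>

lemma DRI_angle:
  fixes p1 p2 p3 \<Theta> :: real
  assumes "p1 > 0" "p3 > 0" "p1\<^sup>2 + p2\<^sup>2 = p3\<^sup>2" and \<Theta>: "\<Theta> = arctan (p1 / (p2 + p3))"
  shows "\<Theta> \<in> {0<..<pi / 2}" "p1 = 2 * p3 * sin \<Theta> * cos \<Theta>"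
    "p2 + p3 = 2 * p3 * (cos \<Theta>)\<^sup>2" "p2 - p3 = - 2 * p3 * (sin \<Theta>)\<^sup>2"
proof -
  have "p1\<^sup>2 > 0" using assms(1) by simp
  then have "\<bar>p2\<bar>\<^sup>2 < p3\<^sup>2" unfolding power2_abs using assms(3) by linarith
  then have "\<bar>p2\<bar> < p3" by (rule power2_less_imp_less) (use assms(2) in simp)
  then have pos: "p2 + p3 > 0" by linarith
  then show \<Theta>_in: "\<Theta> \<in> {0<..<pi / 2}"
    using \<open>p1 > 0\<close> arctan_ubound by (auto simp: \<Theta>)
  then have c: "cos \<Theta> > 0" by (intro cos_gt_zero) auto
  have "tan \<Theta> = p1 / (p2 + p3)" by (simp add: \<Theta> tan_arctan)
  then have s: "sin \<Theta> * (p2 + p3) = p1 * cos \<Theta>"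
    using c pos by (simp add: tan_def field_simps)
  \<comment> \<open>Together with \<open>s\<close> this gives tan^2 \<Theta> = (p3 - p2) / (p3 +
    p2), without denominators.\<close>
  have "p1\<^sup>2 = (p3 - p2) * (p2 + p3)"
    using assms(3) by (simp add: algebra_simps power2_eq_square)
  then have "(p2 + p3) * ((p2 + p3) * (sin \<Theta>)\<^sup>2) = (p2 + p3) * ((p3 - p2) * (cos \<Theta>)\<^sup>2)"
    using s by (metis (no_types, opaque_lifting) mult.assoc mult.commute power2_eq_square power_mult_distrib)
  then have *: "(p2 + p3) * (sin \<Theta>)\<^sup>2 = (p3 - p2) * (cos \<Theta>)\<^sup>2" using pos by simp
  then show 1: "p2 + p3 = 2 * p3 * (cos \<Theta>)\<^sup>2"
    by (simp add: sin_squared_eq algebra_simps)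
  then show "p2 - p3 = - 2 * p3 * (sin \<Theta>)\<^sup>2"
    by (simp add: sin_squared_eq algebra_simps)
  have "p1 * cos \<Theta> = (2 * p3 * sin \<Theta> * cos \<Theta>) * cos \<Theta>"
    using s unfolding 1 by algebra
  then show "p1 = 2 * p3 * sin \<Theta> * cos \<Theta>" using c by simp
qed

text \<open>Up to the factor 2 I, the (D, R) equations are linear; their matrix has kernel vector
  (s, c) and eigenvector (- s, c) with eigenvalue 2 p1. \<open>X\<close> and \<open>Y\<close> are
  the coordinates in this basis, so \<open>X\<close> is constant and Y' = 4 p1 I Y. The factor
  \<open>2 * (2 * p1)\<close> is written to match \<open>riccati_solution\<close> with q = 2
  p1.\<close>

lemma DRI_riccati:
  fixes p1 p3 x \<rho> s c K :: real and D R I y :: "real \<Rightarrow> real"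
  assumes J: "is_interval J" "0 \<in> J"
    and sc: "s \<noteq> 0" "c \<noteq> 0" "s\<^sup>2 + c\<^sup>2 = 1"
    and p: "p1 = 2 * p3 * s * c" "p2 + p3 = 2 * p3 * c\<^sup>2" "p2 - p3 = - 2 * p3 * s\<^sup>2"
    and sol: "solves_DRI_on J p1 p2 p3 D R I"
    and init: "(D 0, R 0, I 0) \<in> S2 \<rho>"
  defines "X \<equiv> \<lambda>t. (D t / s + R t / c) / 2" and "Y \<equiv> \<lambda>t. (R t / c - D t / s) / 2"
  assumes u: "u \<in> J"
  shows "D u = s * (X 0 - Y u)" "R u = c * (X 0 + Y u)"
    "(I has_real_derivative 2 * p1 * ((I u)\<^sup>2 - (Y u)\<^sup>2 - (\<rho>\<^sup>2 - (X 0)\<^sup>2))) (at u within J)"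
    "(Y has_real_derivative 2 * (2 * p1) * I u * Y u) (at u within J)"
proof -
  have conv: "convex J" using J by (simp add: is_interval_convex)
  have DR: "D v = s * (X v - Y v)" "R v = c * (X v + Y v)" for v
    using sc by (auto simp: X_def Y_def field_simps)
  have D': "(D has_real_derivative - 4 * p1 * s * I v * Y v) (at v within J)"
    and R': "(R has_real_derivative 4 * p1 * c * I v * Y v) (at v within J)"
    and I': "(I has_real_derivative - 2 * p1 * ((D v)\<^sup>2 + (R v)\<^sup>2) + 4 * p3 * D v * R v) (at v within J)"
    if "v \<in> J" for v
  proof -
    have "2 * I v * (p1 * D v + (p2 - p3) * R v) = - 4 * p1 * s * I v * Y v"
      "2 * I v * (- (p2 + p3) * D v + p1 * R v) = 4 * p1 * c * I v * Y v"
      unfolding DR p by (simp_all add: algebra_simps power2_eq_square)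
    with sol that show "(D has_real_derivative - 4 * p1 * s * I v * Y v) (at v within J)"
      "(R has_real_derivative 4 * p1 * c * I v * Y v) (at v within J)"
      "(I has_real_derivative - 2 * p1 * ((D v)\<^sup>2 + (R v)\<^sup>2) + 4 * p3 * D v * R v) (at v within J)"
      unfolding solves_DRI_on_def by metis+
  qed
  have "(X has_real_derivative 0) (at v within J)" if "v \<in> J" for v
    unfolding X_def using sc
    by (auto intro!: derivative_eq_intros D'[OF that] R'[OF that] simp: field_simps)
  then have X: "X u = X 0"
    using has_field_derivative_zero_constant[OF conv, of X] J u by metis
  then show "D u = s * (X 0 - Y u)" "R u = c * (X 0 + Y u)" using DR by auto
  show "(Y has_real_derivative 2 * (2 * p1) * I u * Y u) (at u within J)"
  proof -
    have "(Y has_real_derivative (4 * p1 * c * I u * Y u / c - (- 4 * p1 * s * I u * Y u) / s) / 2) (at u within J)"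
      unfolding Y_def
      by (intro DERIV_cdivide DERIV_diff R'[OF u, unfolded Y_def] D'[OF u, unfolded Y_def])
    also have "(4 * p1 * c * I u * Y u / c - (- 4 * p1 * s * I u * Y u) / s) / 2 = 2 * (2 * p1) * I u * Y u"
      using sc by simp
    finally show ?thesis .
  qed
  \<comment> \<open>The vector field is tangent to the spheres about the origin. This allows D^2 +
    R^2 to be replaced by \<rho>^2 - I^2 in the equation for \<open>I\<close>.\<close>
  have "((\<lambda>v. (D v)\<^sup>2 + (R v)\<^sup>2 + (I v)\<^sup>2) has_real_derivative 0) (at v within J)"
    if v: "v \<in> J" for v
  proof -
    have "D v * (2 * I v * (p1 * D v + (p2 - p3) * R v)) + R v * (2 * I v * (- (p2 + p3) * D v + p1 * R v))
        + I v * (- 2 * p1 * ((D v)\<^sup>2 + (R v)\<^sup>2) + 4 * p3 * D v * R v) = 0"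
      by (simp add: algebra_simps power2_eq_square)
    moreover have "(D has_real_derivative 2 * I v * (p1 * D v + (p2 - p3) * R v)) (at v within J)"
      "(R has_real_derivative 2 * I v * (- (p2 + p3) * D v + p1 * R v)) (at v within J)"
      using sol v unfolding solves_DRI_on_def by auto
    ultimately show ?thesis
      by (auto intro!: derivative_eq_intros I'[OF v] simp: algebra_simps)
  qed
  then have "(D u)\<^sup>2 + (R u)\<^sup>2 + (I u)\<^sup>2 = (D 0)\<^sup>2 + (R 0)\<^sup>2 + (I 0)\<^sup>2"
    using has_field_derivative_zero_constant[OF conv, of "\<lambda>v. (D v)\<^sup>2 + (R v)\<^sup>2 + (I v)\<^sup>2"] J(2) u
    by fastforce
  then have cons: "(D u)\<^sup>2 + (R u)\<^sup>2 + (I u)\<^sup>2 = \<rho>\<^sup>2" using init by (simp add: S2_def)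
  \<comment> \<open>Here D R = s c (X^2 - Y^2) and 4 p3 s c = 2 p1.\<close>
  have "4 * p3 * D u * R u = 2 * p1 * ((X 0)\<^sup>2 - (Y u)\<^sup>2)"
    unfolding DR p X by (simp add: algebra_simps power2_eq_square)
  moreover have "2 * p1 * ((D u)\<^sup>2 + (R u)\<^sup>2) = 2 * p1 * (\<rho>\<^sup>2 - (I u)\<^sup>2)"
    by (simp flip: cons)
  ultimately have "- 2 * p1 * ((D u)\<^sup>2 + (R u)\<^sup>2) + 4 * p3 * D u * R u
    = 2 * p1 * ((I u)\<^sup>2 - (Y u)\<^sup>2 - (\<rho>\<^sup>2 - (X 0)\<^sup>2))"
    by (simp add: algebra_simps)
  with I'[OF u] show "(I has_real_derivative 2 * p1 * ((I u)\<^sup>2 - (Y u)\<^sup>2 - (\<rho>\<^sup>2 - (X 0)\<^sup>2))) (at u within J)"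
    by simp
qed

section \<open>The explicit solutions in the three cases\<close>

text \<open>The claims \<open>W \<noteq> 0\<close> ensure that the quotients are genuine and not
  values of x / 0 = 0. In case (2) the fixed point is exempt, since there this default is the
  intended reading of 0 / 0.\<close>

theorem proposition2p25:
  fixes p1 p2 p3 \<Theta> \<rho> X Y r I0 :: real
    and J :: "real set"
    and D R I :: "real \<Rightarrow> real"
  assumes "p1 > 0" and "p2 \<noteq> 0" and "p3 > 0" and "p1\<^sup>2 + p2\<^sup>2 = p3\<^sup>2"
    and "\<Theta> = arctan (p1 / (p2 + p3))"
    and "\<rho> > 0"
    and "is_interval J" and "0 \<in> J"
    and "solves_DRI_on J p1 p2 p3 D R I"
    and "(D 0, R 0, I 0) \<in> S2 \<rho>"
    and "X = 1 / (2 * sin \<Theta>) * D 0 + 1 / (2 * cos \<Theta>) * R 0"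
    and "Y = - (1 / (2 * sin \<Theta>)) * D 0 + 1 / (2 * cos \<Theta>) * R 0"
    and "r = sqrt \<bar>\<rho>\<^sup>2 - X\<^sup>2\<bar>"
    and "I0 = I 0"
  shows "\<Theta> \<in> {0<..<pi / 2} \<and>
    (\<bar>X\<bar> < \<rho> \<longrightarrow>
      (\<forall>t\<in>J. let W = ((r - I0)\<^sup>2 + Y\<^sup>2) * exp (4 * p1 * r * t)
                     + ((r + I0)\<^sup>2 + Y\<^sup>2) * exp (- 4 * p1 * r * t)
                     - 2 * I0\<^sup>2 - 2 * Y\<^sup>2 + 2 * r\<^sup>2
        in W \<noteq> 0 \<and>
           D t = sin \<Theta> * (X - 4 * r\<^sup>2 * Y / W) \<and>
           R t = cos \<Theta> * (X + 4 * r\<^sup>2 * Y / W) \<and>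
           I t = - r * ((((r - I0)\<^sup>2 + Y\<^sup>2) * exp (4 * p1 * r * t)
                          - ((r + I0)\<^sup>2 + Y\<^sup>2) * exp (- 4 * p1 * r * t)) / W))) \<and>
    (\<bar>X\<bar> = \<rho> \<longrightarrow>
      (\<forall>t\<in>J. let W = (2 * p1 * t * (I0\<^sup>2 + Y\<^sup>2) - I0)\<^sup>2 + Y\<^sup>2
        in (\<not> (I0 = 0 \<and> Y = 0) \<longrightarrow> W \<noteq> 0) \<and>
           D t = sin \<Theta> * (X - (I0\<^sup>2 + Y\<^sup>2) * Y / W) \<and>
           R t = cos \<Theta> * (X + (I0\<^sup>2 + Y\<^sup>2) * Y / W) \<and>
           I t = - ((I0\<^sup>2 + Y\<^sup>2) * (2 * p1 * t * (I0\<^sup>2 + Y\<^sup>2) - I0) / W))) \<and>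
    (\<bar>X\<bar> > \<rho> \<longrightarrow>
      (\<forall>t\<in>J. let W = (I0\<^sup>2 + Y\<^sup>2 + r\<^sup>2) - 2 * r * I0 * sin (4 * p1 * r * t)
                     - (I0\<^sup>2 + Y\<^sup>2 - r\<^sup>2) * cos (4 * p1 * r * t)
        in W \<noteq> 0 \<and>
           D t = sin \<Theta> * (X - 2 * r\<^sup>2 * Y / W) \<and>
           R t = cos \<Theta> * (X + 2 * r\<^sup>2 * Y / W) \<and>
           I t = r * ((2 * r * I0 * cos (4 * p1 * r * t)
                        - (I0\<^sup>2 + Y\<^sup>2 - r\<^sup>2) * sin (4 * p1 * r * t)) / W)))"
proof -
  define s c where "s = sin \<Theta>" and "c = cos \<Theta>"
  note angle = DRI_angle[OF assms(1,3,4,5)]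
  have sc: "s \<noteq> 0" "c \<noteq> 0" "s\<^sup>2 + c\<^sup>2 = 1"
    using angle(1) sin_gt_zero[of \<Theta>] cos_gt_zero[of \<Theta>] by (auto simp: s_def c_def)
  define y where "y t = (R t / c - D t / s) / 2" for t
  have X: "X = (D 0 / s + R 0 / c) / 2" and y0: "y 0 = Y"
    unfolding y_def assms(11,12) s_def c_def by (simp_all add: field_simps)
  note ric = DRI_riccati[OF assms(7,8) sc angle(2-4)[folded s_def c_def] assms(9,10),
      folded X y_def]
  have DR: "D t = sin \<Theta> * (X - y t)" "R t = cos \<Theta> * (X + y t)" if "t \<in> J" for t
    using ric(1,2)[OF that] by (simp_all add: s_def c_def)
  \<comment> \<open>The instance has q = 2 p1 and K = \<rho>^2 - X^2; each case supplies its own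
    \<open>C\<close> and \<open>S\<close>.\<close>
  note sol = riccati_solution[OF assms(7,8) _ ric(3,4), unfolded y0, folded assms(14)]
  have case1: "let W = ((r - I0)\<^sup>2 + Y\<^sup>2) * exp (4 * p1 * r * t)
                     + ((r + I0)\<^sup>2 + Y\<^sup>2) * exp (- 4 * p1 * r * t)
                     - 2 * I0\<^sup>2 - 2 * Y\<^sup>2 + 2 * r\<^sup>2
        in W \<noteq> 0 \<and>
           D t = sin \<Theta> * (X - 4 * r\<^sup>2 * Y / W) \<and>
           R t = cos \<Theta> * (X + 4 * r\<^sup>2 * Y / W) \<and>
           I t = - r * ((((r - I0)\<^sup>2 + Y\<^sup>2) * exp (4 * p1 * r * t)
                          - ((r + I0)\<^sup>2 + Y\<^sup>2) * exp (- 4 * p1 * r * t)) / W)"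
    if lt: "\<bar>X\<bar> < \<rho>" and t: "t \<in> J" for t
  proof -
    have "X\<^sup>2 < \<rho>\<^sup>2" using power_strict_mono[OF lt, of 2] by simp
    then have r: "r > 0" "r\<^sup>2 = \<rho>\<^sup>2 - X\<^sup>2" by (auto simp: assms(13))
    \<comment> \<open>K = r^2: dividing sinh by \<open>r\<close> gives S' = q C and C' = q K S, and
      the Wronskian identity is cosh^2 - sinh^2 = 1.\<close>
    define C S where "C u = cosh (2 * p1 * r * u)" and "S u = sinh (2 * p1 * r * u) / r" for u
    define Q where "Q = (C t - I0 * S t)\<^sup>2 + (Y * S t)\<^sup>2"
    define e f where "e = exp (2 * p1 * r * t)" and "f = exp (- (2 * p1 * r * t))"
    have ef: "e * f = 1" by (simp add: e_def f_def flip: exp_add)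
    have e2: "exp (4 * p1 * r * t) = e\<^sup>2" and f2: "exp (- 4 * p1 * r * t) = f\<^sup>2"
      by (simp_all add: e_def f_def flip: exp_double)
    have CS: "C t = (e + f) / 2" "S t = (e - f) / (2 * r)"
      by (simp_all add: C_def S_def cosh_def sinh_def e_def f_def)
    have *: "Q \<noteq> 0 \<and> y t = Y / Q \<and>
      I t = ((C t - I0 * S t) * (I0 * C t - (\<rho>\<^sup>2 - X\<^sup>2) * S t) - Y\<^sup>2 * S t * C t) / Q"
      unfolding Q_def
    proof (rule sol[OF t])
      show "(C has_real_derivative 2 * p1 * (\<rho>\<^sup>2 - X\<^sup>2) * S u) (at u)" for u
        unfolding C_def S_def r(2)[symmetric] using r(1)
        by (auto intro!: derivative_eq_intros simp: power2_eq_square)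
      show "(S has_real_derivative 2 * p1 * C u) (at u)" for u
        unfolding C_def S_def using r(1) by (auto intro!: derivative_eq_intros)
      show "(C t)\<^sup>2 - (\<rho>\<^sup>2 - X\<^sup>2) * (S t)\<^sup>2 = 1"
        unfolding C_def S_def r(2)[symmetric] using r(1)
        by (simp add: power_divide cosh_square_eq)
    qed (simp_all add: C_def S_def)
    \<comment> \<open>\<open>W\<close> is 4 r^2 |\<phi>|^2 expanded in \<open>e\<close> and
      \<open>f\<close>; its time-independent terms come from the mixed product \<open>e * f\<close>
      = 1.\<close>
    have Q4: "((r - I0)\<^sup>2 + Y\<^sup>2) * e\<^sup>2 + ((r + I0)\<^sup>2 + Y\<^sup>2) * f\<^sup>2 - 2 * I0\<^sup>2 - 2 * Y\<^sup>2 + 2 * r\<^sup>2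
      = 4 * r\<^sup>2 * Q"
    proof -
      have "4 * r\<^sup>2 * Q = (r * (e + f) - I0 * (e - f))\<^sup>2 + (Y * (e - f))\<^sup>2"
        using r(1) by (simp add: Q_def CS field_simps power2_eq_square)
      also have "\<dots> = ((r - I0)\<^sup>2 + Y\<^sup>2) * e\<^sup>2 + ((r + I0)\<^sup>2 + Y\<^sup>2) * f\<^sup>2
          + (2 * r\<^sup>2 - 2 * I0\<^sup>2 - 2 * Y\<^sup>2) * (e * f)"
        by (simp add: algebra_simps power2_eq_square)
      finally show ?thesis by (simp add: ef)
    qed
    have I: "(C t - I0 * S t) * (I0 * C t - (\<rho>\<^sup>2 - X\<^sup>2) * S t) - Y\<^sup>2 * S t * C t
      = - r * (((r - I0)\<^sup>2 + Y\<^sup>2) * e\<^sup>2 - ((r + I0)\<^sup>2 + Y\<^sup>2) * f\<^sup>2) / (4 * r\<^sup>2)"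
      unfolding CS r(2)[symmetric] using r(1) by (simp add: field_simps power2_eq_square)
    show ?thesis
      unfolding Let_def e2 f2 Q4 DR[OF t] using * r(1) unfolding I by simp
  qed
  have case2: "let W = (2 * p1 * t * (I0\<^sup>2 + Y\<^sup>2) - I0)\<^sup>2 + Y\<^sup>2
        in (\<not> (I0 = 0 \<and> Y = 0) \<longrightarrow> W \<noteq> 0) \<and>
           D t = sin \<Theta> * (X - (I0\<^sup>2 + Y\<^sup>2) * Y / W) \<and>
           R t = cos \<Theta> * (X + (I0\<^sup>2 + Y\<^sup>2) * Y / W) \<and>
           I t = - ((I0\<^sup>2 + Y\<^sup>2) * (2 * p1 * t * (I0\<^sup>2 + Y\<^sup>2) - I0) / W)"
    if eq: "\<bar>X\<bar> = \<rho>" and t: "t \<in> J" for t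
  proof -
    have K: "\<rho>\<^sup>2 - X\<^sup>2 = 0" using eq by auto
    \<comment> \<open>K = 0: the hyperbolic functions degenerate to C = 1 and a linear
      \<open>S\<close>.\<close>
    define S where "S u = 2 * p1 * u" for u
    define Q where "Q = (1 - I0 * S t)\<^sup>2 + (Y * S t)\<^sup>2"
    have *: "Q \<noteq> 0 \<and> y t = Y / Q \<and>
      I t = ((1 - I0 * S t) * (I0 * 1 - (\<rho>\<^sup>2 - X\<^sup>2) * S t) - Y\<^sup>2 * S t * 1) / Q"
      unfolding Q_def
    proof (rule sol[OF t])
      show "(S has_real_derivative 2 * p1 * 1) (at u)" for u
        unfolding S_def by (auto intro!: derivative_eq_intros)
    qed (simp_all add: K S_def)
    \<comment> \<open>Compared with \<open>Q\<close>, \<open>W\<close> and the numerators carry the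
      extra factor I0^2 + Y^2, which vanishes exactly at the fixed point.\<close>
    have W: "(2 * p1 * t * (I0\<^sup>2 + Y\<^sup>2) - I0)\<^sup>2 + Y\<^sup>2 = (I0\<^sup>2 + Y\<^sup>2) * Q"
      by (simp add: Q_def S_def algebra_simps power2_eq_square)
    have I: "(1 - I0 * S t) * (I0 * 1 - (\<rho>\<^sup>2 - X\<^sup>2) * S t) - Y\<^sup>2 * S t * 1
      = - (2 * p1 * t * (I0\<^sup>2 + Y\<^sup>2) - I0)"
      unfolding K by (simp add: S_def algebra_simps power2_eq_square)
    have "Q \<noteq> 0" "y t = Y / Q" "I t = - ((2 * p1 * t * (I0\<^sup>2 + Y\<^sup>2) - I0) / Q)"
      using * unfolding I minus_divide_left by blast+
    \<comment> \<open>If the extra factor is zero, then \<open>y t\<close> and \<open>I t\<close>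
      are zero, as are the quotients by x / 0 = 0; otherwise it cancels.\<close>
    then show ?thesis
      unfolding Let_def W DR[OF t]
      by (cases "I0\<^sup>2 + Y\<^sup>2 = 0") (auto simp: sum_power2_eq_zero_iff)
  qed
  have case3: "let W = (I0\<^sup>2 + Y\<^sup>2 + r\<^sup>2) - 2 * r * I0 * sin (4 * p1 * r * t)
                     - (I0\<^sup>2 + Y\<^sup>2 - r\<^sup>2) * cos (4 * p1 * r * t)
        in W \<noteq> 0 \<and>
           D t = sin \<Theta> * (X - 2 * r\<^sup>2 * Y / W) \<and>
           R t = cos \<Theta> * (X + 2 * r\<^sup>2 * Y / W) \<and>
           I t = r * ((2 * r * I0 * cos (4 * p1 * r * t)
                        - (I0\<^sup>2 + Y\<^sup>2 - r\<^sup>2) * sin (4 * p1 * r * t)) / W)"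
    if gt: "\<bar>X\<bar> > \<rho>" and t: "t \<in> J" for t
  proof -
    have "X\<^sup>2 > \<rho>\<^sup>2" using power_strict_mono[OF gt, of 2] assms(6) by simp
    then have r: "r > 0" "- r\<^sup>2 = \<rho>\<^sup>2 - X\<^sup>2" by (auto simp: assms(13))
    \<comment> \<open>K = - r^2 turns the hyperbolic functions into trigonometric ones.\<close>
    define C S where "C u = cos (2 * p1 * r * u)" and "S u = sin (2 * p1 * r * u) / r" for u
    define Q where "Q = (C t - I0 * S t)\<^sup>2 + (Y * S t)\<^sup>2"
    define e f where "e = cos (2 * p1 * r * t)" and "f = sin (2 * p1 * r * t)"
    have ef: "e\<^sup>2 + f\<^sup>2 = 1" by (simp add: e_def f_def)
    have e2: "cos (4 * p1 * r * t) = e\<^sup>2 - f\<^sup>2" and f2: "sin (4 * p1 * r * t) = 2 * f * e"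
      using cos_double[of "2 * p1 * r * t"] sin_double[of "2 * p1 * r * t"]
      by (simp_all add: e_def f_def mult.assoc)
    have CS: "C t = e" "S t = f / r"
      by (simp_all add: C_def S_def e_def f_def)
    have *: "Q \<noteq> 0 \<and> y t = Y / Q \<and>
      I t = ((C t - I0 * S t) * (I0 * C t - (\<rho>\<^sup>2 - X\<^sup>2) * S t) - Y\<^sup>2 * S t * C t) / Q"
      unfolding Q_def
    proof (rule sol[OF t])
      show "(C has_real_derivative 2 * p1 * (\<rho>\<^sup>2 - X\<^sup>2) * S u) (at u)" for u
        unfolding C_def S_def r(2)[symmetric] using r(1)
        by (auto intro!: derivative_eq_intros simp: power2_eq_square)
      show "(S has_real_derivative 2 * p1 * C u) (at u)" for u
        unfolding C_def S_def using r(1) by (auto intro!: derivative_eq_intros)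
      show "(C t)\<^sup>2 - (\<rho>\<^sup>2 - X\<^sup>2) * (S t)\<^sup>2 = 1"
        unfolding C_def S_def r(2)[symmetric] using r(1) by (simp add: power_divide)
    qed (simp_all add: C_def S_def)
    \<comment> \<open>Double angles replace the squared exponentials, and the constant term of
      \<open>W\<close> arises from e^2 + f^2 = 1.\<close>
    have W: "(I0\<^sup>2 + Y\<^sup>2 + r\<^sup>2) - 2 * r * I0 * (2 * f * e) - (I0\<^sup>2 + Y\<^sup>2 - r\<^sup>2) * (e\<^sup>2 - f\<^sup>2)
      = 2 * r\<^sup>2 * Q"
    proof -
      have "2 * r\<^sup>2 * Q = 2 * ((r * e - I0 * f)\<^sup>2 + (Y * f)\<^sup>2)"
        using r(1) by (simp add: Q_def CS field_simps power2_eq_square)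
      also have "\<dots> = (I0\<^sup>2 + Y\<^sup>2 + r\<^sup>2) * (e\<^sup>2 + f\<^sup>2) - 2 * r * I0 * (2 * f * e)
          - (I0\<^sup>2 + Y\<^sup>2 - r\<^sup>2) * (e\<^sup>2 - f\<^sup>2)"
        by (simp add: algebra_simps power2_eq_square)
      finally show ?thesis by (simp add: ef)
    qed
    have I: "(C t - I0 * S t) * (I0 * C t - (\<rho>\<^sup>2 - X\<^sup>2) * S t) - Y\<^sup>2 * S t * C t
      = r * (2 * r * I0 * (e\<^sup>2 - f\<^sup>2) - (I0\<^sup>2 + Y\<^sup>2 - r\<^sup>2) * (2 * f * e)) / (2 * r\<^sup>2)"
      unfolding CS r(2)[symmetric] using r(1) by (simp add: field_simps power2_eq_square)
    show ?thesis
      unfolding Let_def e2 f2 W DR[OF t] using * r(1) unfolding I by simp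
  qed
  show ?thesis using angle(1) case1 case2 case3 by blast
qed

end
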